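(* Let $K$ be a field and let $E$ be a directed graph not satisfying Condition (L). Then there exists an $E$-algebraic branching system $\{R_e,D_v,f_e\}_{e\in E^1,v\in E^0}$ on some set $X$ such that the induced representation $\pi:L_K(E)\to \mathrm{Hom}_K(M)$, where $M$ is the $K$-module of all functions $X\to K$, satisfies $\pi(v)\neq 0$ for all $v\in E^0$, but $\pi$ is not faithful (not injective).
   Context: A directed graph $E=(E^0,E^1,r,s)$ consists of two countable sets $E^0$ (vertices), $E^1$ (edges) and maps $r,s:E^1\to E^0$; an edge $e$ points from $s(e)$ to $r(e)$. For $n\ge 1$, a path of length $n$ is a tuple $(\alpha_1,\dots,\alpha_n)$ of edges with $r(\alpha_i)=s(\alpha_{i+1})$ for $1\le i\le n-1$. It is a cycle if $s(\alpha_1)=r(\alpha_n)$. A cycle has no exits if $s^{-1}(s(\alpha_i))=\{\alpha_i\}$ for all $i$; otherwise it has an exit. $E$ satisfies Condition (L) if every cycle of $E$ has an exit. The Leavitt path algebra $L_K(E)$ is the universal $K$-algebra generated by a set $\{v:v\in E^0\}$ of pairwise orthogonal idempotents together with a set $\{e,e^*:e\in E^1\}$ satisfying: (1) $s(e)e=er(e)=e$, $r(e)e^*=e^*s(e)=e^*$ and $e^*f=\delta_{e,f}r(e)$ for all $e,f\in E^1$; (2) $v=\sum_{e\in E^1:s(e)=v}ee^*$ for every vertex $v$ with $0<\#\{e:s(e)=v\}<\infty$. An $E$-algebraic branching system on a set $X$ is a family $\{R_e,D_v,f_e\}_{e\in E^1,v\in E^0}$ of subsets $R_e,D_v\subseteq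 X$ and maps $f_e$ such that: (1) $R_e\cap R_f=\emptyset$ if $e\ne f$; (2) $D_v\cap D_w=\emptyset$ if $v\neq w$; (3) $R_e\subseteq D_{s(e)}$ for all $e\in E^1$; (4) $D_v=\bigcup_{e\in s^{-1}(v)}R_e$ if $0<|s^{-1}(v)|<\infty$; (5) $f_e:D_{r(e)}\to R_e$ is a bijection for each $e\in E^1$. Let $M$ be the $K$-module of all functions $X\to K$ and $\mathrm{Hom}_K(M)$ the $K$-algebra of all $K$-linear maps $M\to M$. The induced representation is the $K$-algebra homomorphism $\pi:L_K(E)\to\mathrm{Hom}_K(M)$ with $\pi(v)(\phi)=\chi_{D_v}\phi$, $\pi(e)(\phi)=\chi_{R_e}\cdot(\phi\circ f_e^{-1})$ and $\pi(e^* )(\phi)=\chi_{D_{r(e)}}\cdot(\phi\circ f_e)$ for all $v\in E^0$, $e\in E^1$, $\phi\in M$ (the functions being understood as $0$ outside $R_e$, respectively $D_{r(e)}$). *)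

theory Defs
  imports
    Complex_Main
    "HOL-Library.Countable_Set"
    "HOL-Library.FuncSet"
    "HOL-Library.Poly_Mapping"
    "Graph_Theory.Digraph"
begin

section \<open>Cycles and Condition (L)\<close>

text \<open>
  A directed graph is a \<^typ>\<open>('v, 'e) pre_digraph\<close> satisfying \<^const>\<open>wf_digraph\<close>; the source
  map is \<^const>\<open>tail\<close>, the range map is \<^const>\<open>head\<close>, and \<open>out_arcs E v\<close> is the preimage of
  \<open>v\<close> under the source map.  A cycle is any closed path of positive length: it may revisit
  vertices, in contrast to the notion of cycle in the Graph Theory entry.
\<close>

definition is_path :: "('v, 'e) pre_digraph \<Rightarrow> 'e list \<Rightarrow> bool" where
  "is_path E \<alpha> \<longleftrightarrow> \<alpha> \<noteq> [] \<and> set \<alpha> \<subseteq> arcs E \<and>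
     (\<forall>i. Suc i < length \<alpha> \<longrightarrow> head E (\<alpha> ! i) = tail E (\<alpha> ! Suc i))"

definition is_cycle :: "('v, 'e) pre_digraph \<Rightarrow> 'e list \<Rightarrow> bool" where
  "is_cycle E \<alpha> \<longleftrightarrow> is_path E \<alpha> \<and> tail E (hd \<alpha>) = head E (last \<alpha>)"

definition has_exit :: "('v, 'e) pre_digraph \<Rightarrow> 'e list \<Rightarrow> bool" where
  "has_exit E \<alpha> \<longleftrightarrow> \<not> (\<forall>e \<in> set \<alpha>. out_arcs E (tail E e) = {e})"

definition condition_L :: "('v, 'e) pre_digraph \<Rightarrow> bool" where
  "condition_L E \<longleftrightarrow> (\<forall>\<alpha>. is_cycle E \<alpha> \<longrightarrow> has_exit E \<alpha>)"

section \<open>Algebras with explicit carrier\<close>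

text \<open>
  Algebras need not have a unit: the Leavitt path algebra of a graph with infinitely many
  vertices has none.
\<close>

record ('k, 'a) kalgebra =
  alg_carrier :: "'a set"
  alg_zero :: 'a
  alg_add :: "'a \<Rightarrow> 'a \<Rightarrow> 'a"
  alg_mult :: "'a \<Rightarrow> 'a \<Rightarrow> 'a"
  alg_scale :: "'k \<Rightarrow> 'a \<Rightarrow> 'a"

definition alg_hom ::
  "('k, 'a) kalgebra \<Rightarrow> ('k, 'b) kalgebra \<Rightarrow> ('a \<Rightarrow> 'b) \<Rightarrow> bool" where
  "alg_hom A B h \<longleftrightarrow>
     h \<in> alg_carrier A \<rightarrow> alg_carrier B \<and>
     (\<forall>x \<in> alg_carrier A. \<forall>y \<in> alg_carrier A. h (alg_add A x y) = alg_add B (h x) (h y)) \<and>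
     (\<forall>x \<in> alg_carrier A. \<forall>y \<in> alg_carrier A. h (alg_mult A x y) = alg_mult B (h x) (h y)) \<and>
     (\<forall>c. \<forall>x \<in> alg_carrier A. h (alg_scale A c x) = alg_scale B c (h x))"

section \<open>The Leavitt path algebra\<close>

text \<open>
  The algebra is constructed as the free non-unital \<open>K\<close>-algebra on the vertices, edges and
  ghost edges modulo the two-sided ideal generated by the defining relations.  Words form an
  additively written monoid under concatenation, so that finitely supported functions on
  words carry the convolution product of \<^theory>\<open>HOL-Library.Poly_Mapping\<close>.
\<close>

datatype ('v, 'e) lpa_gen = Vertex 'v | Edge 'e | Ghost 'e

datatype 'a word = Word (letters: "'a list")

instantiation word :: (type) monoid_add
begin

definition zero_word :: "'a word" where
  "zero_word = Word []"

definition plus_word :: "'a word \<Rightarrow> 'a word \<Rightarrow> 'a word" where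
  "plus_word u w = Word (letters u @ letters w)"

instance
  by standard (simp_all add: zero_word_def plus_word_def)

end

type_synonym ('v, 'e, 'k) free_elem = "('v, 'e) lpa_gen word \<Rightarrow>\<^sub>0 'k"

definition lpa_gens :: "('v, 'e) pre_digraph \<Rightarrow> ('v, 'e) lpa_gen set" where
  "lpa_gens E = Vertex ` verts E \<union> Edge ` arcs E \<union> Ghost ` arcs E"

text \<open>Excluding the empty word makes the free algebra non-unital.\<close>

definition free_alg :: "('v, 'e) pre_digraph \<Rightarrow> ('v, 'e, 'k::field) free_elem set" where
  "free_alg E = {p. \<forall>w \<in> Poly_Mapping.keys p. letters w \<noteq> [] \<and> set (letters w) \<subseteq> lpa_gens E}"

definition free_scale :: "'k::field \<Rightarrow> ('v, 'e, 'k) free_elem \<Rightarrow> ('v, 'e, 'k) free_elem" where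
  "free_scale c p = Poly_Mapping.map ((*) c) p"

definition free_gen :: "('v, 'e) lpa_gen \<Rightarrow> ('v, 'e, 'k::field) free_elem" where
  "free_gen g = Poly_Mapping.single (Word [g]) 1"

abbreviation fV :: "'v \<Rightarrow> ('v, 'e, 'k::field) free_elem" where
  "fV v \<equiv> free_gen (Vertex v)"

abbreviation fE :: "'e \<Rightarrow> ('v, 'e, 'k::field) free_elem" where
  "fE e \<equiv> free_gen (Edge e)"

abbreviation fG :: "'e \<Rightarrow> ('v, 'e, 'k::field) free_elem" where
  "fG e \<equiv> free_gen (Ghost e)"

definition lpa_relations :: "('v, 'e) pre_digraph \<Rightarrow> ('v, 'e, 'k::field) free_elem set" where
  "lpa_relations E =
     {fV v * fV v - fV v | v. v \<in> verts E} \<union>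
     {fV v * fV w | v w. v \<in> verts E \<and> w \<in> verts E \<and> v \<noteq> w} \<union>
     {fV (tail E e) * fE e - fE e | e. e \<in> arcs E} \<union>
     {fE e * fV (head E e) - fE e | e. e \<in> arcs E} \<union>
     {fV (head E e) * fG e - fG e | e. e \<in> arcs E} \<union>
     {fG e * fV (tail E e) - fG e | e. e \<in> arcs E} \<union>
     {fG e * fE e - fV (head E e) | e. e \<in> arcs E} \<union>
     {fG e * fE f | e f. e \<in> arcs E \<and> f \<in> arcs E \<and> e \<noteq> f} \<union>
     {fV v - (\<Sum>e \<in> out_arcs E v. fE e * fG e) | v.
        v \<in> verts E \<and> finite (out_arcs E v) \<and> out_arcs E v \<noteq> {}}"

inductive_set lpa_ideal :: "('v, 'e) pre_digraph \<Rightarrow> ('v, 'e, 'k::field) free_elem set"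
  for E :: "('v, 'e) pre_digraph" where
  relation: "p \<in> lpa_relations E \<Longrightarrow> p \<in> lpa_ideal E"
| zero: "0 \<in> lpa_ideal E"
| add: "p \<in> lpa_ideal E \<Longrightarrow> q \<in> lpa_ideal E \<Longrightarrow> p + q \<in> lpa_ideal E"
| scale: "p \<in> lpa_ideal E \<Longrightarrow> free_scale c p \<in> lpa_ideal E"
| mult_left: "a \<in> free_alg E \<Longrightarrow> p \<in> lpa_ideal E \<Longrightarrow> a * p \<in> lpa_ideal E"
| mult_right: "a \<in> free_alg E \<Longrightarrow> p \<in> lpa_ideal E \<Longrightarrow> p * a \<in> lpa_ideal E"

definition lpa_rel ::
  "('v, 'e) pre_digraph \<Rightarrow> (('v, 'e, 'k::field) free_elem \<times> ('v, 'e, 'k) free_elem) set" where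
  "lpa_rel E = {(p, q). p \<in> free_alg E \<and> q \<in> free_alg E \<and> p - q \<in> lpa_ideal E}"

definition lpa_class ::
  "('v, 'e) pre_digraph \<Rightarrow> ('v, 'e, 'k::field) free_elem \<Rightarrow> ('v, 'e, 'k) free_elem set" where
  "lpa_class E p = lpa_rel E `` {p}"

definition LPA ::
  "('v, 'e) pre_digraph \<Rightarrow> ('k::field, ('v, 'e, 'k) free_elem set) kalgebra" where
  "LPA E =
     \<lparr> alg_carrier = free_alg E // lpa_rel E,
       alg_zero = lpa_class E 0,
       alg_add = (\<lambda>A B. \<Union>a \<in> A. \<Union>b \<in> B. lpa_class E (a + b)),
       alg_mult = (\<lambda>A B. \<Union>a \<in> A. \<Union>b \<in> B. lpa_class E (a * b)),
       alg_scale = (\<lambda>c A. \<Union>a \<in> A. lpa_class E (free_scale c a)) \<rparr>"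

definition lpa_vertex ::
  "('v, 'e) pre_digraph \<Rightarrow> 'v \<Rightarrow> ('v, 'e, 'k::field) free_elem set" where
  "lpa_vertex E v = lpa_class E (fV v)"

definition lpa_edge ::
  "('v, 'e) pre_digraph \<Rightarrow> 'e \<Rightarrow> ('v, 'e, 'k::field) free_elem set" where
  "lpa_edge E e = lpa_class E (fE e)"

definition lpa_ghost ::
  "('v, 'e) pre_digraph \<Rightarrow> 'e \<Rightarrow> ('v, 'e, 'k::field) free_elem set" where
  "lpa_ghost E e = lpa_class E (fG e)"

section \<open>Algebraic branching systems and their representations\<close>

text \<open>Only the restriction of \<open>f e\<close> to \<open>D (head E e)\<close> is relevant.\<close>

definition branching_system ::
  "('v, 'e) pre_digraph \<Rightarrow> 'x set \<Rightarrow> ('e \<Rightarrow> 'x set) \<Rightarrow> ('v \<Rightarrow> 'x set) \<Rightarrow> ('e \<Rightarrow> 'x \<Rightarrow> 'x) \<Rightarrow> bool"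
where
  "branching_system E X R D f \<longleftrightarrow>
     (\<forall>e \<in> arcs E. R e \<subseteq> X) \<and>
     (\<forall>v \<in> verts E. D v \<subseteq> X) \<and>
     (\<forall>e \<in> arcs E. \<forall>e' \<in> arcs E. e \<noteq> e' \<longrightarrow> R e \<inter> R e' = {}) \<and>
     (\<forall>v \<in> verts E. \<forall>w \<in> verts E. v \<noteq> w \<longrightarrow> D v \<inter> D w = {}) \<and>
     (\<forall>e \<in> arcs E. R e \<subseteq> D (tail E e)) \<and>
     (\<forall>v \<in> verts E. finite (out_arcs E v) \<and> out_arcs E v \<noteq> {} \<longrightarrow>
        D v = (\<Union>e \<in> out_arcs E v. R e)) \<and>
     (\<forall>e \<in> arcs E. bij_betw (f e) (D (head E e)) (R e))"

text \<open>
  A function \<open>X \<rightarrow> K\<close> is represented by its extension by zero to the whole type, so that the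
  pointwise operations of the module are those of the ambient function type.
\<close>

definition fun_module :: "'x set \<Rightarrow> ('x \<Rightarrow> 'k::field) set" where
  "fun_module X = {\<phi>. \<forall>x. x \<notin> X \<longrightarrow> \<phi> x = 0}"

text \<open>
  Linear maps are extensional on the module, so that they are equal iff they agree on it.
\<close>

definition linear_maps :: "'x set \<Rightarrow> (('x \<Rightarrow> 'k::field) \<Rightarrow> ('x \<Rightarrow> 'k)) set" where
  "linear_maps X = {T. T \<in> fun_module X \<rightarrow>\<^sub>E fun_module X \<and>
     (\<forall>\<phi> \<in> fun_module X. \<forall>\<psi> \<in> fun_module X. T (\<lambda>x. \<phi> x + \<psi> x) = (\<lambda>x. T \<phi> x + T \<psi> x)) \<and>
     (\<forall>c. \<forall>\<phi> \<in> fun_module X. T (\<lambda>x. c * \<phi> x) = (\<lambda>x. c * T \<phi> x))}"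

definition Hom_alg ::
  "'x set \<Rightarrow> ('k::field, ('x \<Rightarrow> 'k) \<Rightarrow> ('x \<Rightarrow> 'k)) kalgebra" where
  "Hom_alg X =
     \<lparr> alg_carrier = linear_maps X,
       alg_zero = (\<lambda>\<phi> \<in> fun_module X. \<lambda>x. 0),
       alg_add = (\<lambda>S T. \<lambda>\<phi> \<in> fun_module X. \<lambda>x. S \<phi> x + T \<phi> x),
       alg_mult = (\<lambda>S T. \<lambda>\<phi> \<in> fun_module X. S (T \<phi>)),
       alg_scale = (\<lambda>c T. \<lambda>\<phi> \<in> fun_module X. \<lambda>x. c * T \<phi> x) \<rparr>"

text \<open>
  On the carrier of the Leavitt path algebra, a homomorphism is determined by its values on
  the generators, so there is at most one such \<open>\<pi>\<close> up to its behaviour off the carrier.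
\<close>

definition induced_representation ::
  "('v, 'e) pre_digraph \<Rightarrow> 'x set \<Rightarrow> ('e \<Rightarrow> 'x set) \<Rightarrow> ('v \<Rightarrow> 'x set) \<Rightarrow> ('e \<Rightarrow> 'x \<Rightarrow> 'x) \<Rightarrow>
     (('v, 'e, 'k::field) free_elem set \<Rightarrow> ('x \<Rightarrow> 'k) \<Rightarrow> ('x \<Rightarrow> 'k)) \<Rightarrow> bool" where
  "induced_representation E X R D f \<pi> \<longleftrightarrow>
     alg_hom (LPA E) (Hom_alg X) \<pi> \<and>
     (\<forall>v \<in> verts E. \<forall>\<phi> \<in> fun_module X.
        \<pi> (lpa_vertex E v) \<phi> = (\<lambda>x. if x \<in> D v then \<phi> x else 0)) \<and>
     (\<forall>e \<in> arcs E. \<forall>\<phi> \<in> fun_module X.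
        \<pi> (lpa_edge E e) \<phi> =
          (\<lambda>x. if x \<in> R e then \<phi> (inv_into (D (head E e)) (f e) x) else 0)) \<and>
     (\<forall>e \<in> arcs E. \<forall>\<phi> \<in> fun_module X.
        \<pi> (lpa_ghost E e) \<phi> = (\<lambda>x. if x \<in> D (head E e) then \<phi> (f e x) else 0))"

end

theory Submission
  imports Defs
begin

text \<open>
  Let \<open>\<alpha>\<close> be a cycle without exits, based at \<open>v\<close>.  Give every vertex \<open>w\<close> a copy \<open>D w\<close> of the
  integers and split it among the edges leaving \<open>w\<close>; if there is a single such edge \<open>e\<close>, let \<open>f e\<close>
  be translation by an integer \<open>d\<close>.  In the induced representation, \<open>\<alpha>\<close> then acts on functions on
  \<open>D v\<close> as translation by \<open>d\<close> times the length of \<open>\<alpha>\<close>.  For \<open>d = 0\<close> the elements \<open>\<alpha>\<close> and \<open>v\<close> have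
  the same image, whereas for \<open>d = 1\<close> their images differ, so that \<open>\<alpha> \<noteq> v\<close> in the Leavitt path
  algebra.
\<close>

section \<open>The quotient algebra\<close>

lemma lookup_free_scale [simp]:
  "Poly_Mapping.lookup (free_scale c p) w = c * Poly_Mapping.lookup p w"
  by (simp add: free_scale_def Poly_Mapping.map.rep_eq when_def)

lemma free_scale_minus: "free_scale c (p - q) = free_scale c p - free_scale c q"
  by (rule poly_mapping_eqI) (simp add: lookup_minus right_diff_distrib)

lemma free_scale_uminus_one: "free_scale (-1) p = - p"
  by (rule poly_mapping_eqI) simp

text \<open>Setting a new value at a key outside the support amounts to adding a monomial, so
  monomials generate everything under addition. Zero is covered as the monomial with coefficient
  0.\<close>

lemma poly_mapping_single_induct [case_names single sum]:
  assumes single: "\<And>w c. P (Poly_Mapping.single w c)"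
    and sum: "\<And>p q. P p \<Longrightarrow> P q \<Longrightarrow> P (p + q)"
  shows "P (p :: 'a \<Rightarrow>\<^sub>0 'b::comm_monoid_add)"
proof (induction p rule: update_induct)
  case const
  then show ?case
    using single[of _ 0] by simp
next
  case (update p w c)
  then have "Poly_Mapping.update w c p = p + Poly_Mapping.single w c"
    by (intro poly_mapping_eqI) (auto simp: lookup_update lookup_add lookup_single in_keys_iff)
  then show ?case
    using update by (simp add: single sum)
qed

lemma free_alg_add: "p \<in> free_alg E \<Longrightarrow> q \<in> free_alg E \<Longrightarrow> p + q \<in> free_alg E"
  using Poly_Mapping.keys_add[of p q] unfolding free_alg_def by blast

lemma free_alg_mult: "p \<in> free_alg E \<Longrightarrow> q \<in> free_alg E \<Longrightarrow> p * q \<in> free_alg E"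
  using keys_mult[of p q] unfolding free_alg_def by (fastforce simp: plus_word_def)

lemma free_alg_scale:
  assumes "p \<in> free_alg E"
  shows "free_scale c p \<in> free_alg E"
proof -
  have "Poly_Mapping.keys (free_scale c p) \<subseteq> Poly_Mapping.keys p"
    by (auto simp: in_keys_iff)
  then show ?thesis
    using assms unfolding free_alg_def by blast
qed

lemma free_alg_word:
  "xs \<noteq> [] \<Longrightarrow> set xs \<subseteq> lpa_gens E \<Longrightarrow> Poly_Mapping.single (Word xs) 1 \<in> free_alg E"
  by (simp add: free_alg_def)

section \<open>Congruence modulo the ideal and the operations on classes\<close>

lemma lpa_ideal_uminus: "p \<in> lpa_ideal E \<Longrightarrow> - p \<in> lpa_ideal E"
  using lpa_ideal.scale[of p E "-1"] by (simp add: free_scale_uminus_one)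

lemma equiv_lpa_rel: "equiv (free_alg E) (lpa_rel E)"
proof (rule equivI)
  show "lpa_rel E \<subseteq> free_alg E \<times> free_alg E"
    by (auto simp: lpa_rel_def)
  show "refl_on (free_alg E) (lpa_rel E)"
    by (auto simp: lpa_rel_def refl_on_def lpa_ideal.zero)
  show "sym (lpa_rel E)"
    using lpa_ideal_uminus by (fastforce simp: lpa_rel_def sym_def)
  show "trans (lpa_rel E)"
  proof (rule transI)
    fix p q r
    assume "(p, q) \<in> lpa_rel E" "(q, r) \<in> lpa_rel E"
    then show "(p, r) \<in> lpa_rel E"
      using lpa_ideal.add[of "p - q" E "q - r"] by (simp add: lpa_rel_def)
  qed
qed

lemma lpa_class_eqI: "(p, q) \<in> lpa_rel E \<Longrightarrow> lpa_class E p = lpa_class E q"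
  unfolding lpa_class_def by (rule equiv_class_eq[OF equiv_lpa_rel])

lemma lpa_class_in_carrier: "p \<in> free_alg E \<Longrightarrow> lpa_class E p \<in> alg_carrier (LPA E)"
  by (simp add: LPA_def lpa_class_def quotientI)

lemma LPA_carrierE:
  assumes "A \<in> alg_carrier (LPA E)"
  obtains p where "p \<in> free_alg E" "A = lpa_class E p"
  using assms by (auto simp: LPA_def lpa_class_def elim: quotientE)

text \<open>The operations of \<open>LPA\<close> are unions over all representatives. Since the
  congruence is respected, all sets in the union coincide, and later computations can use any chosen
  representatives.\<close>

lemma alg_add_LPA:
  fixes p q :: "('v, 'e, 'k::field) free_elem"
  assumes "p \<in> free_alg E" "q \<in> free_alg E"
  shows "alg_add (LPA E) (lpa_class E p) (lpa_class E q) = lpa_class E (p + q)"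
proof -
  have "(\<lambda>a b :: ('v, 'e, 'k) free_elem. lpa_class E (a + b)) respects2 lpa_rel E"
  proof (intro congruent2I' lpa_class_eqI)
    fix p p' q q' :: "('v, 'e, 'k) free_elem"
    assume "(p, p') \<in> lpa_rel E" "(q, q') \<in> lpa_rel E"
    then show "(p + q, p' + q') \<in> lpa_rel E"
      using lpa_ideal.add[of "p - p'" E "q - q'"]
      by (auto simp: lpa_rel_def free_alg_add algebra_simps)
  qed
  then have "(\<Union>a \<in> lpa_rel E `` {p}. \<Union>b \<in> lpa_rel E `` {q}. lpa_class E (a + b)) =
      lpa_class E (p + q)"
    by (rule UN_equiv_class2[OF equiv_lpa_rel equiv_lpa_rel _ assms])
  then show ?thesis
    by (simp add: LPA_def lpa_class_def)
qed

lemma alg_mult_LPA: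
  fixes p q :: "('v, 'e, 'k::field) free_elem"
  assumes "p \<in> free_alg E" "q \<in> free_alg E"
  shows "alg_mult (LPA E) (lpa_class E p) (lpa_class E q) = lpa_class E (p * q)"
proof -
  have "(\<lambda>a b :: ('v, 'e, 'k) free_elem. lpa_class E (a * b)) respects2 lpa_rel E"
  proof (intro congruent2I' lpa_class_eqI)
    fix p p' q q' :: "('v, 'e, 'k) free_elem"
    assume *: "(p, p') \<in> lpa_rel E" "(q, q') \<in> lpa_rel E"
    \<comment> \<open>The difference \<open>p * q - p' * q'\<close> equals
      \<open>p * (q - q') + (p - p') * q'\<close>, and both summands lie in the ideal because it is
      two-sided.\<close>
    then have "p * (q - q') \<in> lpa_ideal E" "(p - p') * q' \<in> lpa_ideal E"
      by (auto simp: lpa_rel_def intro: lpa_ideal.mult_left lpa_ideal.mult_right)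
    then have "p * (q - q') + (p - p') * q' \<in> lpa_ideal E"
      by (rule lpa_ideal.add)
    then show "(p * q, p' * q') \<in> lpa_rel E"
      using * by (auto simp: lpa_rel_def free_alg_mult algebra_simps)
  qed
  then have "(\<Union>a \<in> lpa_rel E `` {p}. \<Union>b \<in> lpa_rel E `` {q}. lpa_class E (a * b)) =
      lpa_class E (p * q)"
    by (rule UN_equiv_class2[OF equiv_lpa_rel equiv_lpa_rel _ assms])
  then show ?thesis
    by (simp add: LPA_def lpa_class_def)
qed

lemma alg_scale_LPA:
  fixes p :: "('v, 'e, 'k::field) free_elem"
  assumes "p \<in> free_alg E"
  shows "alg_scale (LPA E) c (lpa_class E p) = lpa_class E (free_scale c p)"
proof -
  have "(\<lambda>a. lpa_class E (free_scale c a)) respects lpa_rel E"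
  proof (rule congruentI)
    fix p q :: "('v, 'e, 'k) free_elem"
    assume "(p, q) \<in> lpa_rel E"
    then show "lpa_class E (free_scale c p) = lpa_class E (free_scale c q)"
      using lpa_ideal.scale[of "p - q" E c]
      by (intro lpa_class_eqI) (auto simp: lpa_rel_def free_alg_scale free_scale_minus)
  qed
  then have "(\<Union>a \<in> lpa_rel E `` {p}. lpa_class E (free_scale c a)) = lpa_class E (free_scale c p)"
    by (rule UN_equiv_class[OF equiv_lpa_rel _ assms])
  then show ?thesis
    by (simp add: LPA_def lpa_class_def)
qed

section \<open>The induced representation\<close>

locale branching_rep =
  fixes E :: "('v, 'e) pre_digraph" and X :: "'x set"
    and R :: "'e \<Rightarrow> 'x set" and D :: "'v \<Rightarrow> 'x set" and f :: "'e \<Rightarrow> 'x \<Rightarrow> 'x"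
  assumes wf: "wf_digraph E"
    and branching: "branching_system E X R D f"
begin

text \<open>These are the formulas of the induced representation, but acting on all functions on the
  ambient type; the restriction to the module is postponed to \<open>rep\<close>.\<close>

fun gen_op :: "('v, 'e) lpa_gen \<Rightarrow> ('x \<Rightarrow> 'k::field) \<Rightarrow> 'x \<Rightarrow> 'k" where
  "gen_op (Vertex v) \<phi> = (\<lambda>x. if x \<in> D v then \<phi> x else 0)"
| "gen_op (Edge e) \<phi> = (\<lambda>x. if x \<in> R e then \<phi> (inv_into (D (head E e)) (f e) x) else 0)"
| "gen_op (Ghost e) \<phi> = (\<lambda>x. if x \<in> D (head E e) then \<phi> (f e x) else 0)"

text \<open>With \<open>foldr\<close> the last letter acts first, which matches the product of
  \<open>Hom_alg\<close>, namely composition.\<close>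

definition word_op :: "('v, 'e) lpa_gen word \<Rightarrow> ('x \<Rightarrow> 'k::field) \<Rightarrow> 'x \<Rightarrow> 'k" where
  "word_op w \<phi> = foldr gen_op (letters w) \<phi>"

definition free_op :: "('v, 'e, 'k::field) free_elem \<Rightarrow> ('x \<Rightarrow> 'k) \<Rightarrow> 'x \<Rightarrow> 'k" where
  "free_op p \<phi> x = (\<Sum>w \<in> Poly_Mapping.keys p. Poly_Mapping.lookup p w * word_op w \<phi> x)"

text \<open>The chosen representative does not matter, by \<open>rep_class\<close>: two
  representatives differ by an element of the ideal, which acts as zero. The restriction makes the
  result extensional, as \<open>linear_maps\<close> demands.\<close>

definition rep :: "('v, 'e, 'k::field) free_elem set \<Rightarrow> ('x \<Rightarrow> 'k) \<Rightarrow> 'x \<Rightarrow> 'k" where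
  "rep A = restrict (free_op (SOME p. p \<in> A)) (fun_module X)"

section \<open>Linearity of the action, both in the function and in the algebra element, and
  multiplicativity\<close>

lemma gen_op_add: "gen_op g (\<lambda>x. \<phi> x + \<psi> x) = (\<lambda>x. gen_op g \<phi> x + gen_op g \<psi> x)"
  by (cases g) auto

lemma gen_op_scale: "gen_op g (\<lambda>x. c * \<phi> x) = (\<lambda>x. c * gen_op g \<phi> x)"
  by (cases g) auto

lemma word_op_add: "word_op w (\<lambda>x. \<phi> x + \<psi> x) = (\<lambda>x. word_op w \<phi> x + word_op w \<psi> x)"
proof -
  have "foldr gen_op xs (\<lambda>x. \<phi> x + \<psi> x) = (\<lambda>x. foldr gen_op xs \<phi> x + foldr gen_op xs \<psi> x)" for xs
    by (induction xs) (simp_all add: gen_op_add)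
  then show ?thesis
    by (simp add: word_op_def)
qed

lemma word_op_scale: "word_op w (\<lambda>x. c * \<phi> x) = (\<lambda>x. c * word_op w \<phi> x)"
proof -
  have "foldr gen_op xs (\<lambda>x. c * \<phi> x) = (\<lambda>x. c * foldr gen_op xs \<phi> x)" for xs
    by (induction xs) (simp_all add: gen_op_scale)
  then show ?thesis
    by (simp add: word_op_def)
qed

lemma word_op_plus: "word_op (u + w) \<phi> = word_op u (word_op w \<phi>)"
  by (simp add: word_op_def plus_word_def)

lemma free_op_linear_add: "free_op p (\<lambda>x. \<phi> x + \<psi> x) = (\<lambda>x. free_op p \<phi> x + free_op p \<psi> x)"
  by (simp add: free_op_def fun_eq_iff word_op_add distrib_left sum.distrib)

lemma free_op_linear_scale: "free_op p (\<lambda>x. c * \<phi> x) = (\<lambda>x. c * free_op p \<phi> x)"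
  by (simp add: free_op_def fun_eq_iff word_op_scale sum_distrib_left algebra_simps)

lemma free_op_linear_zero: "free_op p (\<lambda>x. 0) = (\<lambda>x. 0)"
  using free_op_linear_scale[of p 0 "\<lambda>x. 0"] by simp

text \<open>Added summands have coefficient 0. This allows elements with different supports to be
  summed over one common index set.\<close>

lemma free_op_superset:
  assumes "finite S" "Poly_Mapping.keys p \<subseteq> S"
  shows "free_op p \<phi> x = (\<Sum>w \<in> S. Poly_Mapping.lookup p w * word_op w \<phi> x)"
  unfolding free_op_def using assms
  by (intro sum.mono_neutral_left) (auto simp: in_keys_iff)

lemma free_op_zero: "free_op 0 \<phi> = (\<lambda>x. 0)"
  by (simp add: free_op_def fun_eq_iff)

lemma free_op_add: "free_op (p + q) \<phi> = (\<lambda>x. free_op p \<phi> x + free_op q \<phi> x)"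
proof
  fix x
  let ?S = "Poly_Mapping.keys p \<union> Poly_Mapping.keys q"
  have "finite ?S"
    by simp
  then show "free_op (p + q) \<phi> x = free_op p \<phi> x + free_op q \<phi> x"
    using Poly_Mapping.keys_add[of p q]
    by (simp add: free_op_superset[of ?S] lookup_add distrib_right sum.distrib)
qed

lemma free_op_scale: "free_op (free_scale c p) \<phi> = (\<lambda>x. c * free_op p \<phi> x)"
proof
  fix x
  have "Poly_Mapping.keys (free_scale c p) \<subseteq> Poly_Mapping.keys p"
    by (auto simp: in_keys_iff)
  then have "free_op (free_scale c p) \<phi> x =
      (\<Sum>w \<in> Poly_Mapping.keys p. Poly_Mapping.lookup (free_scale c p) w * word_op w \<phi> x)"
    by (intro free_op_superset) auto
  then show "free_op (free_scale c p) \<phi> x = c * free_op p \<phi> x"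
    by (simp add: free_op_def sum_distrib_left mult.assoc)
qed

lemma free_op_minus: "free_op (p - q) \<phi> = (\<lambda>x. free_op p \<phi> x - free_op q \<phi> x)"
  using free_op_add[of p "- q" \<phi>] free_op_scale[of "-1" q \<phi>]
  by (simp add: free_scale_uminus_one)

lemma free_op_sum: "free_op (\<Sum>i \<in> S. p i) \<phi> = (\<lambda>x. \<Sum>i \<in> S. free_op (p i) \<phi> x)"
  by (induction S rule: infinite_finite_induct) (simp_all add: free_op_zero free_op_add)

lemma free_op_single: "free_op (Poly_Mapping.single w c) \<phi> = (\<lambda>x. c * word_op w \<phi> x)"
  by (cases "c = 0") (simp_all add: free_op_def fun_eq_iff)

lemma free_op_gen: "free_op (free_gen g) \<phi> = gen_op g \<phi>"
  by (simp add: free_gen_def free_op_single word_op_def)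

text \<open>Both sides are additive in \<open>p\<close> and in \<open>q\<close>, so two inductions
  reduce the claim to monomials, where concatenation of words becomes composition.\<close>

lemma free_op_mult: "free_op (p * q) \<phi> = free_op p (free_op q \<phi>)"
proof -
  have single_mult: "free_op (Poly_Mapping.single u a * q) \<phi> =
      free_op (Poly_Mapping.single u a) (free_op q \<phi>)" for u a
  proof (induction q rule: poly_mapping_single_induct)
    case (single w b)
    then show ?case
      by (simp add: mult_single free_op_single word_op_plus word_op_scale algebra_simps)
  next
    case (sum q r)
    then show ?case
      by (simp add: distrib_left free_op_add free_op_linear_add)
  qed
  show ?thesis
  proof (induction p rule: poly_mapping_single_induct)
    case (single u a)
    show ?case
      by (rule single_mult)
  next
    case (sum p r)
    then show ?case
      by (simp add: distrib_right free_op_add)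
  qed
qed

section \<open>Consequences of the branching axioms and vanishing on the ideal\<close>

lemma head_in_verts: "e \<in> arcs E \<Longrightarrow> head E e \<in> verts E"
  and tail_in_verts: "e \<in> arcs E \<Longrightarrow> tail E e \<in> verts E"
  using wf by (simp_all add: wf_digraph_def)

lemma R_subset_D: "e \<in> arcs E \<Longrightarrow> x \<in> R e \<Longrightarrow> x \<in> D (tail E e)"
  using branching unfolding branching_system_def by blast

lemma f_bij: "e \<in> arcs E \<Longrightarrow> bij_betw (f e) (D (head E e)) (R e)"
  using branching unfolding branching_system_def by blast

lemma R_disjoint: "e \<in> arcs E \<Longrightarrow> e' \<in> arcs E \<Longrightarrow> x \<in> R e \<Longrightarrow> x \<in> R e' \<Longrightarrow> e = e'"
  using branching unfolding branching_system_def by blast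

lemma D_disjoint: "v \<in> verts E \<Longrightarrow> w \<in> verts E \<Longrightarrow> x \<in> D v \<Longrightarrow> x \<in> D w \<Longrightarrow> v = w"
  using branching unfolding branching_system_def by blast

lemma f_in_R: "e \<in> arcs E \<Longrightarrow> x \<in> D (head E e) \<Longrightarrow> f e x \<in> R e"
  using f_bij bij_betwE by blast

text \<open>Pointwise content of the relations for a product of a ghost edge and an edge.\<close>

lemma f_in_R_iff:
  "e \<in> arcs E \<Longrightarrow> e' \<in> arcs E \<Longrightarrow> x \<in> D (head E e) \<Longrightarrow> f e x \<in> R e' \<longleftrightarrow> e = e'"
  using f_in_R R_disjoint by blast

lemma inv_f_in_D: "e \<in> arcs E \<Longrightarrow> x \<in> R e \<Longrightarrow> inv_into (D (head E e)) (f e) x \<in> D (head E e)"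
  using f_bij by (metis bij_betw_imp_surj_on inv_into_into)

lemma f_inv_f: "e \<in> arcs E \<Longrightarrow> x \<in> R e \<Longrightarrow> f e (inv_into (D (head E e)) (f e) x) = x"
  using f_bij by (metis bij_betw_inv_into_right)

lemma inv_f_f: "e \<in> arcs E \<Longrightarrow> x \<in> D (head E e) \<Longrightarrow> inv_into (D (head E e)) (f e) (f e x) = x"
  using f_bij by (metis bij_betw_inv_into_left)

text \<open>Each generator cuts off outside some \<open>D v\<close> or \<open>R e\<close>, hence
  outside \<open>X\<close>, whatever the function \<open>\<phi>\<close> is.\<close>

lemma gen_op_in_fun_module:
  assumes "g \<in> lpa_gens E"
  shows "gen_op g \<phi> \<in> fun_module X"
proof -
  have "\<forall>e \<in> arcs E. R e \<subseteq> X" "\<forall>v \<in> verts E. D v \<subseteq> X"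
    using branching by (simp_all add: branching_system_def)
  then show ?thesis
    using assms head_in_verts by (cases g) (auto simp: lpa_gens_def fun_module_def)
qed

text \<open>Words occurring in \<open>free_alg\<close> are nonempty, so the outermost letter already
  puts the result into the module.\<close>

lemma free_op_in_fun_module:
  assumes "p \<in> free_alg E"
  shows "free_op p \<phi> \<in> fun_module X"
proof -
  have "word_op w \<phi> \<in> fun_module X" if "w \<in> Poly_Mapping.keys p" for w
  proof -
    have "letters w \<noteq> []" "set (letters w) \<subseteq> lpa_gens E"
      using assms that by (auto simp: free_alg_def)
    then show ?thesis
      by (cases "letters w") (auto simp: word_op_def gen_op_in_fun_module)
  qed
  then show ?thesis
    by (simp add: fun_module_def free_op_def)
qed

text \<open>An edge times its ghost acts as multiplication by the indicator of \<open>R e\<close>.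
  As the sets \<open>R e\<close> partition \<open>D v\<close>, these indicators add up to that of
  \<open>D v\<close>.\<close>

lemma gen_op_sum_edges:
  assumes "v \<in> verts E" and fin: "finite (out_arcs E v)" and "out_arcs E v \<noteq> {}"
  shows "(\<Sum>e \<in> out_arcs E v. gen_op (Edge e) (gen_op (Ghost e) \<phi>) x) = gen_op (Vertex v) \<phi> x"
proof -
  have D: "D v = (\<Union>e \<in> out_arcs E v. R e)"
    using branching assms unfolding branching_system_def by blast
  have "gen_op (Edge e) (gen_op (Ghost e) \<phi>) x = (if x \<in> R e then \<phi> x else 0)"
    if "e \<in> out_arcs E v" for e
    using that by (simp add: inv_f_in_D f_inv_f)
  then have *: "(\<Sum>e \<in> out_arcs E v. gen_op (Edge e) (gen_op (Ghost e) \<phi>) x) =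
      (\<Sum>e \<in> out_arcs E v. if x \<in> R e then \<phi> x else 0)"
    by (rule sum.cong[OF refl])
  show ?thesis
  proof (cases "x \<in> D v")
    case True
    then obtain e where e: "e \<in> out_arcs E v" "x \<in> R e"
      using D by auto
    then have "(\<Sum>e \<in> out_arcs E v. if x \<in> R e then \<phi> x else 0) =
        (\<Sum>e' \<in> out_arcs E v. if e' = e then \<phi> x else 0)"
      by (intro sum.cong) (auto dest: R_disjoint)
    then show ?thesis
      using * True e fin by simp
  next
    case False
    then show ?thesis
      using * D by (auto intro!: sum.neutral)
  qed
qed

text \<open>The cases are the families of relations in their order of definition. All but the last
  are pointwise computations from disjointness and from the inverse laws for \<open>f e\<close>; the
  last is the sum relation, settled by \<open>gen_op_sum_edges\<close>.\<close>

lemma free_op_relation: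
  assumes "p \<in> lpa_relations E"
  shows "free_op p \<phi> = (\<lambda>x. 0)"
  using assms unfolding lpa_relations_def
proof (elim UnE, goal_cases)
  case 9
  then obtain v where "p = fV v - (\<Sum>e \<in> out_arcs E v. fE e * fG e)"
    "v \<in> verts E" "finite (out_arcs E v)" "out_arcs E v \<noteq> {}"
    by blast
  then show ?case
    using gen_op_sum_edges[of v \<phi>]
    by (simp add: free_op_minus free_op_sum free_op_mult free_op_gen del: gen_op.simps)
qed (auto simp: fun_eq_iff free_op_minus free_op_mult free_op_gen R_subset_D f_in_R_iff inv_f_in_D
    f_inv_f inv_f_f dest: D_disjoint)

text \<open>The function varies in the induction: for a product \<open>p * a\<close> the hypothesis
  on \<open>p\<close> is applied to \<open>free_op a \<phi>\<close>. For \<open>a * p\<close> a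
  linear map is applied to zero.\<close>

lemma free_op_ideal: "p \<in> lpa_ideal E \<Longrightarrow> free_op p \<phi> = (\<lambda>x. 0)"
proof (induction arbitrary: \<phi> rule: lpa_ideal.induct)
  case (relation p)
  then show ?case
    by (rule free_op_relation)
qed (simp_all add: free_op_zero free_op_add free_op_scale free_op_mult free_op_linear_zero)

section \<open>Descent of the action to the Leavitt path algebra\<close>

lemma rep_class:
  assumes "p \<in> free_alg E"
  shows "rep (lpa_class E p) = restrict (free_op p) (fun_module X)"
proof -
  let ?q = "SOME q. q \<in> lpa_class E p"
  have "p \<in> lpa_class E p"
    unfolding lpa_class_def by (rule equiv_class_self[OF equiv_lpa_rel assms])
  then have "?q \<in> lpa_class E p"
    by (rule someI)
  moreover have "p - q \<in> lpa_ideal E" if "q \<in> lpa_class E p" for q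
    using that by (simp add: lpa_class_def lpa_rel_def)
  ultimately have "p - ?q \<in> lpa_ideal E"
    by blast
  then have "free_op p = free_op ?q"
    using free_op_ideal[of "p - ?q"] by (simp add: free_op_minus fun_eq_iff)
  then show ?thesis
    by (simp add: rep_def)
qed

lemma rep_in_linear_maps:
  fixes p :: "('v, 'e, 'k::field) free_elem"
  assumes "p \<in> free_alg E"
  shows "restrict (free_op p) (fun_module X) \<in> linear_maps X"
proof -
  have "(\<lambda>x. \<phi> x + \<psi> x) \<in> fun_module X" "(\<lambda>x. c * \<phi> x) \<in> fun_module X"
    if "\<phi> \<in> fun_module X" "\<psi> \<in> fun_module X" for \<phi> \<psi> :: "'x \<Rightarrow> 'k" and c
    using that by (simp_all add: fun_module_def)
  then show ?thesis
    using assms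
    by (simp add: linear_maps_def free_op_in_fun_module free_op_linear_add free_op_linear_scale)
qed

text \<open>On representatives these are the rules for \<open>free_op\<close>. For products, the
  inner value must lie in the module, since only there does the restricted outer map agree with
  \<open>free_op\<close>.\<close>

lemma alg_hom_rep:
  "alg_hom (LPA E) (Hom_alg X) (rep :: ('v, 'e, 'k::field) free_elem set \<Rightarrow> _)"
  unfolding alg_hom_def
proof (intro conjI ballI allI funcsetI)
  fix A :: "('v, 'e, 'k) free_elem set"
  assume "A \<in> alg_carrier (LPA E)"
  then show "rep A \<in> alg_carrier (Hom_alg X)"
    by (elim LPA_carrierE) (simp add: rep_class Hom_alg_def rep_in_linear_maps)
next
  fix A B :: "('v, 'e, 'k) free_elem set"
  assume "A \<in> alg_carrier (LPA E)" "B \<in> alg_carrier (LPA E)"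
  then show "rep (alg_add (LPA E) A B) = alg_add (Hom_alg X) (rep A) (rep B)"
    by (elim LPA_carrierE)
      (auto simp: alg_add_LPA rep_class free_alg_add Hom_alg_def free_op_add restrict_def fun_eq_iff)
next
  fix A B :: "('v, 'e, 'k) free_elem set"
  assume "A \<in> alg_carrier (LPA E)" "B \<in> alg_carrier (LPA E)"
  then show "rep (alg_mult (LPA E) A B) = alg_mult (Hom_alg X) (rep A) (rep B)"
    by (elim LPA_carrierE)
      (auto simp: alg_mult_LPA rep_class free_alg_mult Hom_alg_def free_op_mult restrict_def
        fun_eq_iff free_op_in_fun_module)
next
  fix c and A :: "('v, 'e, 'k) free_elem set"
  assume "A \<in> alg_carrier (LPA E)"
  then show "rep (alg_scale (LPA E) c A) = alg_scale (Hom_alg X) c (rep A)"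
    by (elim LPA_carrierE)
      (auto simp: alg_scale_LPA rep_class free_alg_scale Hom_alg_def free_op_scale restrict_def
        fun_eq_iff)
qed

lemma free_gen_in_free_alg: "g \<in> lpa_gens E \<Longrightarrow> free_gen g \<in> free_alg E"
  by (simp add: free_gen_def free_alg_word)

lemma rep_gen:
  "g \<in> lpa_gens E \<Longrightarrow> \<phi> \<in> fun_module X \<Longrightarrow> rep (lpa_class E (free_gen g)) \<phi> = gen_op g \<phi>"
  by (simp add: rep_class free_gen_in_free_alg free_op_gen)

lemma induced_representation_rep: "induced_representation E X R D f rep"
  unfolding induced_representation_def lpa_vertex_def lpa_edge_def lpa_ghost_def
  by (simp add: alg_hom_rep rep_gen lpa_gens_def)

end

section \<open>Translations on integer fibres\<close>

lemma is_path_ConsD: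
  assumes "is_path E (e # es)" "es \<noteq> []"
  shows "head E e = tail E (hd es)" "is_path E es"
proof -
  have *: "head E ((e # es) ! i) = tail E ((e # es) ! Suc i)" if "Suc i < length (e # es)" for i
    using assms(1) that unfolding is_path_def by blast
  show "head E e = tail E (hd es)"
    using *[of 0] assms(2) by (cases es) auto
  show "is_path E es"
    using assms *[of "Suc i" for i] by (auto simp: is_path_def)
qed

text \<open>A single outgoing edge receives all integers by translation. If there are several,
  possibly infinitely many, countability of the edges makes a bijection available.\<close>

lemma ex_edge_splitting:
  fixes E :: "('v, 'e) pre_digraph" and d :: int
  assumes "countable (arcs E)"
  shows "\<exists>h :: 'e \<Rightarrow> int \<Rightarrow> int.
    (\<forall>v. out_arcs E v \<noteq> {} \<longrightarrow> bij_betw (\<lambda>(e, n). h e n) (out_arcs E v \<times> UNIV) UNIV) \<and>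
    (\<forall>e. out_arcs E (tail E e) = {e} \<longrightarrow> (\<forall>n. h e n = n + d))"
proof -
  have "\<exists>H :: 'e \<times> int \<Rightarrow> int. (out_arcs E v \<noteq> {} \<longrightarrow> bij_betw H (out_arcs E v \<times> UNIV) UNIV) \<and>
      (\<forall>e. out_arcs E v = {e} \<longrightarrow> (\<forall>n. H (e, n) = n + d))" for v
  proof (cases "\<exists>e. out_arcs E v = {e}")
    case True
    then obtain e where e: "out_arcs E v = {e}"
      by blast
    have "bij_betw (\<lambda>(e, n). n + d) ({e} \<times> UNIV) UNIV"
      by (rule bij_betwI[where g = "\<lambda>n. (e, n - d)"]) auto
    then show ?thesis
      using e by (intro exI[of _ "\<lambda>(e, n). n + d"]) auto
  next
    case False
    show ?thesis
    proof (cases "out_arcs E v = {}")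
      case True
      then show ?thesis by simp
    next
      case ne: False
      have "countable (out_arcs E v)"
        using assms by (rule countable_subset[rotated]) (auto simp: out_arcs_def)
      then have "countable (out_arcs E v \<times> (UNIV :: int set))"
        by simp
      moreover have "infinite (out_arcs E v \<times> (UNIV :: int set))"
        using ne by (auto simp: finite_cartesian_product_iff infinite_UNIV_int)
      \<comment> \<open>Both sets are countably infinite, so their enumerations by the naturals
        compose to a bijection.\<close>
      ultimately obtain H where "bij_betw H (out_arcs E v \<times> (UNIV :: int set)) (UNIV :: int set)"
        using bij_betw_trans[OF to_nat_on_infinite
            bij_betw_from_nat_into[OF countableI_type infinite_UNIV_int]]
        by blast
      then show ?thesis
        using False by blast
    qed
  qed
  then obtain H :: "'v \<Rightarrow> 'e \<times> int \<Rightarrow> int" where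
    H: "\<And>v. out_arcs E v \<noteq> {} \<Longrightarrow> bij_betw (H v) (out_arcs E v \<times> UNIV) UNIV"
      "\<And>v e n. out_arcs E v = {e} \<Longrightarrow> H v (e, n) = n + d"
    by metis
  \<comment> \<open>The bijections chosen vertex by vertex are glued: each edge uses the one at its
    source.\<close>
  have "bij_betw (\<lambda>(e, n). H (tail E e) (e, n)) (out_arcs E v \<times> UNIV) UNIV"
    if "out_arcs E v \<noteq> {}" for v
    using H(1)[OF that] by (rule bij_betw_cong[THEN iffD1, rotated]) auto
  then show ?thesis
    using H(2) by (intro exI[of _ "\<lambda>e n. H (tail E e) (e, n)"]) auto
qed

text \<open>The injection \<open>\<iota>\<close> places disjoint copies of the integers, one per
  vertex, in a single type. The translation \<open>d\<close> stays a parameter because the values 0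
  and 1 are both used.\<close>

locale integer_fibres =
  fixes E :: "('v, 'e) pre_digraph" and \<iota> :: "'v \<times> int \<Rightarrow> 'x" and h :: "'e \<Rightarrow> int \<Rightarrow> int"
    and d :: int
  assumes wf: "wf_digraph E"
    and inj_\<iota>: "inj_on \<iota> (verts E \<times> UNIV)"
    and h_bij: "out_arcs E v \<noteq> {} \<Longrightarrow> bij_betw (\<lambda>(e, n). h e n) (out_arcs E v \<times> UNIV) UNIV"
    and h_translation: "out_arcs E (tail E e) = {e} \<Longrightarrow> h e n = n + d"
begin

definition fibre :: "'v \<Rightarrow> 'x set" where
  "fibre v = range (\<lambda>n. \<iota> (v, n))"

definition edge_range :: "'e \<Rightarrow> 'x set" where
  "edge_range e = range (\<lambda>n. \<iota> (tail E e, h e n))"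

definition edge_map :: "'e \<Rightarrow> 'x \<Rightarrow> 'x" where
  "edge_map e x = \<iota> (tail E e, h e (snd (inv_into (verts E \<times> UNIV) \<iota> x)))"

section \<open>The branching system on the fibres\<close>

lemma \<iota>_eq_iff: "v \<in> verts E \<Longrightarrow> w \<in> verts E \<Longrightarrow> \<iota> (v, m) = \<iota> (w, n) \<longleftrightarrow> v = w \<and> m = n"
  using inj_on_eq_iff[OF inj_\<iota>, of "(v, m)" "(w, n)"] by simp

lemma h_eq_iff:
  assumes "e \<in> arcs E" "e' \<in> arcs E" "tail E e = tail E e'"
  shows "h e m = h e' n \<longleftrightarrow> e = e' \<and> m = n"
proof -
  have *: "e \<in> out_arcs E (tail E e)" "e' \<in> out_arcs E (tail E e)"
    using assms by auto
  then have "out_arcs E (tail E e) \<noteq> {}"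
    by blast
  then have "inj_on (\<lambda>(e, n). h e n) (out_arcs E (tail E e) \<times> UNIV)"
    by (rule bij_betw_imp_inj_on[OF h_bij])
  then show ?thesis
    using inj_onD[of _ _ "(e, m)" "(e', n)"] * by fastforce
qed

lemma edge_map_\<iota>: "v \<in> verts E \<Longrightarrow> edge_map e (\<iota> (v, n)) = \<iota> (tail E e, h e n)"
  by (simp add: edge_map_def inv_into_f_f[OF inj_\<iota>])

lemma edge_map_bij:
  assumes "e \<in> arcs E"
  shows "bij_betw (edge_map e) (fibre (head E e)) (edge_range e)"
proof -
  have "head E e \<in> verts E" "tail E e \<in> verts E"
    using assms wf by (simp_all add: wf_digraph_def)
  then show ?thesis
    using h_eq_iff[OF assms assms]
    by (auto simp: bij_betw_def inj_on_def fibre_def edge_range_def edge_map_\<iota> \<iota>_eq_iff image_image)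
qed

text \<open>Injectivity of the splitting separates edges with a common source, and disjoint fibres
  separate the others. Surjectivity makes the edge ranges exhaust the fibre of every vertex that
  emits an edge.\<close>

lemma branching_system_fibres:
  "branching_system E (\<Union>v \<in> verts E. fibre v) edge_range fibre edge_map"
proof -
  have tail: "tail E e \<in> verts E" if "e \<in> arcs E" for e
    using that wf by (simp add: wf_digraph_def)
  have sub: "edge_range e \<subseteq> fibre (tail E e)" for e
    by (auto simp: edge_range_def fibre_def)
  have disj: "edge_range e \<inter> edge_range e' = {}" if "e \<in> arcs E" "e' \<in> arcs E" "e \<noteq> e'" for e e'
    using that tail h_eq_iff by (auto simp: edge_range_def \<iota>_eq_iff)
  have un: "fibre v = (\<Union>e \<in> out_arcs E v. edge_range e)" if "out_arcs E v \<noteq> {}" for v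
  proof
    show "fibre v \<subseteq> (\<Union>e \<in> out_arcs E v. edge_range e)"
    proof
      fix x assume "x \<in> fibre v"
      then obtain n where x: "x = \<iota> (v, n)"
        by (auto simp: fibre_def)
      have "n \<in> (\<lambda>(e, n). h e n) ` (out_arcs E v \<times> UNIV)"
        using h_bij[OF that] by (simp add: bij_betw_def)
      then show "x \<in> (\<Union>e \<in> out_arcs E v. edge_range e)"
        using x by (auto simp: edge_range_def)
    qed
    show "(\<Union>e \<in> out_arcs E v. edge_range e) \<subseteq> fibre v"
      using sub by fastforce
  qed
  have dv: "fibre v \<inter> fibre w = {}" if "v \<in> verts E" "w \<in> verts E" "v \<noteq> w" for v w
    using that by (auto simp: fibre_def \<iota>_eq_iff)
  show ?thesis
    unfolding branching_system_def
    using sub tail disj un dv edge_map_bij by (auto; blast)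
qed

sublocale branching_rep E "\<Union>v \<in> verts E. fibre v" edge_range fibre edge_map
  by (rule branching_rep.intro) (fact wf, fact branching_system_fibres)

text \<open>Each edge of such a path has the whole fibre of its source as range and acts as
  translation by \<open>d\<close> between fibres; the translations add up along the path. Off the
  first fibre the outermost edge gives 0.\<close>

lemma no_exit_path_op:
  fixes \<phi> :: "'x \<Rightarrow> 'k::field"
  assumes "is_path E \<alpha>" "\<forall>e \<in> set \<alpha>. out_arcs E (tail E e) = {e}"
  shows "(\<forall>n. foldr gen_op (map Edge \<alpha>) \<phi> (\<iota> (tail E (hd \<alpha>), n)) =
      \<phi> (\<iota> (head E (last \<alpha>), n - int (length \<alpha>) * d))) \<and>
    (\<forall>x. x \<notin> fibre (tail E (hd \<alpha>)) \<longrightarrow> foldr gen_op (map Edge \<alpha>) \<phi> x = 0)"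
  using assms
proof (induction \<alpha>)
  case Nil
  then show ?case
    by (simp add: is_path_def)
next
  case (Cons e es)
  have e: "e \<in> arcs E" and single: "out_arcs E (tail E e) = {e}"
    using Cons.prems by (auto simp: is_path_def)
  have shift: "edge_map e (\<iota> (head E e, n - d)) = \<iota> (tail E e, n)" for n
    using e by (simp add: edge_map_\<iota> head_in_verts h_translation[OF single])
  \<comment> \<open>The source emits just this edge, so the union axiom has a single term.\<close>
  have range: "edge_range e = fibre (tail E e)"
    using branching_system_fibres single tail_in_verts[OF e]
    unfolding branching_system_def by fastforce
  have inv: "inv_into (fibre (head E e)) (edge_map e) (\<iota> (tail E e, n)) = \<iota> (head E e, n - d)" for n
    unfolding shift[symmetric, of n] by (rule inv_f_f[OF e]) (simp add: fibre_def)
  have op: "gen_op (Edge e) \<psi> (\<iota> (tail E e, n)) = \<psi> (\<iota> (head E e, n - d))" for \<psi> :: "'x \<Rightarrow> 'k" and n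
    by (simp add: range inv) (simp add: fibre_def)
  show ?case
  proof (cases "es = []")
    case True
    then show ?thesis
      using op by (simp add: range)
  next
    case False
    then show ?thesis
      using Cons.IH Cons.prems(2) is_path_ConsD[OF Cons.prems(1) False] op
      by (simp add: range algebra_simps)
  qed
qed

text \<open>The fibre over \<open>v\<close> is nonempty, and the indicator of one of its points is
  fixed by the operator of \<open>v\<close>.\<close>

lemma rep_vertex_nonzero:
  assumes v: "v \<in> verts E"
  shows "rep (lpa_vertex E v :: ('v, 'e, 'k::field) free_elem set) \<noteq>
    alg_zero (Hom_alg (\<Union>v \<in> verts E. fibre v))"
proof
  let ?\<phi> = "(\<lambda>x. if x = \<iota> (v, 0) then 1 else 0) :: 'x \<Rightarrow> 'k"
  have mem: "\<iota> (v, 0) \<in> fibre v"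
    by (simp add: fibre_def)
  then have \<phi>: "?\<phi> \<in> fun_module (\<Union>v \<in> verts E. fibre v)"
    using v by (auto simp: fun_module_def)
  assume "rep (lpa_vertex E v :: ('v, 'e, 'k) free_elem set) =
    alg_zero (Hom_alg (\<Union>v \<in> verts E. fibre v))"
  then have "rep (lpa_vertex E v) ?\<phi> (\<iota> (v, 0)) = 0"
    using \<phi> by (simp add: Hom_alg_def)
  then show False
    using v mem rep_gen[OF _ \<phi>, of "Vertex v"] by (simp add: lpa_vertex_def lpa_gens_def)
qed

end

section \<open>Existence of the fibres inside the reals, and the comparison of two
  translations\<close>

lemma ex_integer_fibres:
  assumes "wf_digraph E" "countable (verts E)" "countable (arcs E)"
  obtains \<iota> :: "'v \<times> int \<Rightarrow> real" and h where "integer_fibres (E :: ('v, 'e) pre_digraph) \<iota> h d"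
proof -
  \<comment> \<open>Countability gives an embedding into the naturals and thence into the reals, one
    ambient type for all graphs.\<close>
  have "countable (verts E \<times> (UNIV :: int set))"
    using assms by simp
  then obtain j :: "'v \<times> int \<Rightarrow> nat" where "inj_on j (verts E \<times> UNIV)"
    by (rule countableE)
  then have "inj_on (\<lambda>z. real (j z)) (verts E \<times> UNIV)"
    by (auto simp: inj_on_def)
  moreover obtain h :: "'e \<Rightarrow> int \<Rightarrow> int" where
    "\<And>v. out_arcs E v \<noteq> {} \<Longrightarrow> bij_betw (\<lambda>(e, n). h e n) (out_arcs E v \<times> UNIV) UNIV"
    "\<And>e n. out_arcs E (tail E e) = {e} \<Longrightarrow> h e n = n + d"
    using ex_edge_splitting[OF assms(3), of d] by blast
  ultimately have "integer_fibres E (\<lambda>z. real (j z)) h d"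
    using assms(1) by (intro integer_fibres.intro) auto
  then show thesis
    by (rule that)
qed

theorem theorem3p6:
  fixes E :: "('v, 'e) pre_digraph"
  assumes "wf_digraph E" and "countable (verts E)" and "countable (arcs E)"
    and "\<not> condition_L E"
  shows "\<exists>(X :: real set) R D f. branching_system E X R D f \<and>
    (\<exists>\<pi> :: ('v, 'e, 'k::field) free_elem set \<Rightarrow> (real \<Rightarrow> 'k) \<Rightarrow> (real \<Rightarrow> 'k).
       induced_representation E X R D f \<pi> \<and>
       (\<forall>v \<in> verts E. \<pi> (lpa_vertex E v) \<noteq> alg_zero (Hom_alg X)) \<and>
       \<not> inj_on \<pi> (alg_carrier (LPA E)))"
proof -
  obtain \<alpha> where cycle: "is_cycle E \<alpha>" and no_exit: "\<forall>e \<in> set \<alpha>. out_arcs E (tail E e) = {e}"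
    using assms(4) by (auto simp: condition_L_def has_exit_def)
  then have path: "is_path E \<alpha>" and \<alpha>: "\<alpha> \<noteq> []" "set \<alpha> \<subseteq> arcs E"
    and closed: "head E (last \<alpha>) = tail E (hd \<alpha>)"
    by (auto simp: is_cycle_def is_path_def)
  define v where "v = tail E (hd \<alpha>)"
  have v: "v \<in> verts E"
    using wf_digraph.tail_in_verts[OF assms(1)] \<alpha> hd_in_set[OF \<alpha>(1)] unfolding v_def by blast
  \<comment> \<open>The cycle as a monomial of the free algebra, to be compared with its base
    vertex.\<close>
  define a :: "('v, 'e, 'k) free_elem" where "a = Poly_Mapping.single (Word (map Edge \<alpha>)) 1"
  have a: "a \<in> free_alg E"
    unfolding a_def using \<alpha> by (intro free_alg_word) (auto simp: lpa_gens_def)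
  have fV: "fV v \<in> (free_alg E :: ('v, 'e, 'k) free_elem set)"
    unfolding free_gen_def using v by (intro free_alg_word) (auto simp: lpa_gens_def)

  have distinct: "lpa_class E a \<noteq> lpa_class E (fV v)"
  proof
    assume eq: "lpa_class E a = lpa_class E (fV v)"
    obtain \<iota> :: "'v \<times> int \<Rightarrow> real" and h where "integer_fibres E \<iota> h 1"
      using ex_integer_fibres[OF assms(1-3)] .
    then interpret shift: integer_fibres E \<iota> h 1 .
    let ?\<phi> = "(\<lambda>x. if x = \<iota> (v, 0) then 1 else 0) :: real \<Rightarrow> 'k"
    have mem: "\<iota> (v, 0) \<in> shift.fibre v"
      by (simp add: shift.fibre_def)
    then have \<phi>: "?\<phi> \<in> fun_module (\<Union>v \<in> verts E. shift.fibre v)"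
      using v by (auto simp: fun_module_def)
    have "shift.rep (lpa_class E a) ?\<phi> = shift.rep (lpa_class E (fV v)) ?\<phi>"
      by (simp only: eq)
    then have "shift.free_op a ?\<phi> (\<iota> (v, 0)) = shift.free_op (fV v) ?\<phi> (\<iota> (v, 0))"
      by (simp only: shift.rep_class[OF a] shift.rep_class[OF fV] restrict_apply'[OF \<phi>])
    \<comment> \<open>With \<open>d = 1\<close> the cycle reads off the point mass at the integer
      \<open>- length \<alpha>\<close>, which differs from 0 as the cycle is nonempty.\<close>
    moreover have "shift.free_op a ?\<phi> (\<iota> (v, 0)) = ?\<phi> (\<iota> (v, - int (length \<alpha>)))"
      using shift.no_exit_path_op[OF path no_exit, of ?\<phi>] closed
      by (simp add: a_def shift.free_op_single shift.word_op_def v_def)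
    moreover have "shift.free_op (fV v) ?\<phi> (\<iota> (v, 0)) = 1"
      using mem by (simp add: shift.free_op_gen)
    ultimately show False
      using v \<alpha>(1) by (simp add: shift.\<iota>_eq_iff)
  qed

  \<comment> \<open>The system with \<open>d = 0\<close> is the one that witnesses the
    theorem.\<close>
  obtain \<iota> :: "'v \<times> int \<Rightarrow> real" and h where "integer_fibres E \<iota> h 0"
    using ex_integer_fibres[OF assms(1-3)] .
  then interpret fixed: integer_fibres E \<iota> h 0 .
  \<comment> \<open>On the fibre over \<open>v\<close> both operators leave values unchanged, since
    the cycle returns to \<open>v\<close> without translation; elsewhere both give 0.\<close>
  have "fixed.free_op a \<phi> x = fixed.free_op (fV v) \<phi> x" for \<phi> x
  proof (cases "x \<in> fixed.fibre v")
    case True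
    then obtain n where "x = \<iota> (v, n)"
      by (auto simp: fixed.fibre_def)
    then show ?thesis
      using fixed.no_exit_path_op[OF path no_exit, of \<phi>] closed True
      by (simp add: a_def fixed.free_op_single fixed.word_op_def fixed.free_op_gen v_def)
  next
    case False
    then show ?thesis
      using fixed.no_exit_path_op[OF path no_exit, of \<phi>]
      by (simp add: a_def fixed.free_op_single fixed.word_op_def fixed.free_op_gen v_def)
  qed
  then have "fixed.rep (lpa_class E a) = fixed.rep (lpa_class E (fV v))"
    by (simp add: fixed.rep_class[OF a] fixed.rep_class[OF fV] restrict_def fun_eq_iff)
  then have "\<not> inj_on fixed.rep (alg_carrier (LPA E) :: ('v, 'e, 'k) free_elem set set)"
    using distinct lpa_class_in_carrier[OF a] lpa_class_in_carrier[OF fV] by (metis inj_onD)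
  then show ?thesis
    using fixed.branching_system_fibres fixed.induced_representation_rep fixed.rep_vertex_nonzero
    by blast
qed

end
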